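(* Let $P_n$ be the path on $n$ vertices, where $n\ge2$. Then $\dim_f^k(P_2)=k$ for every real $k\in[1,2]$ and, for $n\ge3$, $$\dim_f^k(P_n)=\begin{cases} k & \text{if } k\in[1,2],\\ 2+(k-2)\frac{n-2}{n-3} & \text{if } k\in(2,n-1].\end{cases}$$
   Context: For a finite simple connected graph $G$ with at least two vertices, $d(x,y)$ is the length of a shortest path between $x$ and $y$. For distinct $x,y\in V(G)$, let $R\{x,y\}=\{z\in V(G): d(x,z)\neq d(y,z)\}$, and let $\kappa(G)=\min\{|R\{x,y\}|: x\neq y,\ x,y\in V(G)\}$. For a function $g$ on $V(G)$ and $U\subseteq V(G)$, write $g(U)=\sum_{s\in U}g(s)$. For a real number $k\in[1,\kappa(G)]$, a function $g:V(G)\to[0,1]$ is a $k$-resolving function of $G$ if $g(R\{x,y\})\ge k$ for any two distinct vertices $x,y\in V(G)$; the fractional $k$-metric dimension is $\dim_f^k(G)=\min\{g(V(G)): g \text{ is a } k\text{-resolving function of } G\}$. For $n=3$ the interval $(2,n-1]$ is empty. *)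

theory Defs
  imports Complex_Main "Graph_Theory.Digraph_Component"
begin

text \<open>
  A finite simple graph is a \<^locale>\<open>pair_graph\<close>: a finite, loop-free, symmetric digraph without
  parallel arcs, where the edge \<open>uv\<close> is the pair of arcs \<open>(u,v)\<close>, \<open>(v,u)\<close>.
\<close>

definition simple_connected_graph :: "'a pair_pre_digraph \<Rightarrow> bool" where
  "simple_connected_graph G \<longleftrightarrow>
     pair_graph G \<and> Digraph_Component.connected (with_proj G) \<and> 2 \<le> card (pverts G)"

text \<open>
  The definitions below are meant for graphs satisfying \<^const>\<open>simple_connected_graph\<close>;
  elsewhere their values are unspecified or meaningless.
  A path is represented by its list of arcs, so its length is the length of that list.
\<close>

definition gdist :: "'a pair_pre_digraph \<Rightarrow> 'a \<Rightarrow> 'a \<Rightarrow> nat" where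
  "gdist G x y = (LEAST l. \<exists>p. pre_digraph.apath (with_proj G) x p y \<and> length p = l)"

definition resolving_nbhd :: "'a pair_pre_digraph \<Rightarrow> 'a \<Rightarrow> 'a \<Rightarrow> 'a set" where
  "resolving_nbhd G x y = {z \<in> pverts G. gdist G x z \<noteq> gdist G y z}"

definition kappa :: "'a pair_pre_digraph \<Rightarrow> nat" where
  "kappa G = Min {card (resolving_nbhd G x y) | x y. x \<in> pverts G \<and> y \<in> pverts G \<and> x \<noteq> y}"

text \<open>
  Functions on \<open>V(G)\<close> are total functions whose values outside \<open>V(G)\<close> are irrelevant.
  The standing restriction \<open>k \<in> [1, \<kappa>(G)]\<close> is part of the definition, so nothing is
  \<open>k\<close>-resolving for \<open>k\<close> outside that interval.
\<close>

definition k_resolving :: "'a pair_pre_digraph \<Rightarrow> real \<Rightarrow> ('a \<Rightarrow> real) \<Rightarrow> bool" where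
  "k_resolving G k g \<longleftrightarrow>
     1 \<le> k \<and> k \<le> real (kappa G) \<and>
     (\<forall>v \<in> pverts G. g v \<in> {0..1}) \<and>
     (\<forall>x \<in> pverts G. \<forall>y \<in> pverts G. x \<noteq> y \<longrightarrow> k \<le> sum g (resolving_nbhd G x y))"

text \<open>
  A genuine minimum: the \<open>LEAST\<close> value over the reals is specified only if it is attained
  (unlike an infimum).
\<close>

definition frac_k_metric_dim :: "'a pair_pre_digraph \<Rightarrow> real \<Rightarrow> real" where
  "frac_k_metric_dim G k = (LEAST w. \<exists>g. k_resolving G k g \<and> w = sum g (pverts G))"

definition path_graph :: "nat \<Rightarrow> nat pair_pre_digraph" where
  "path_graph n =
     \<lparr> pverts = {..<n}, parcs = {(i, j). i < n \<and> j < n \<and> (j = i + 1 \<or> i = j + 1)} \<rparr>"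

lemma pair_graph_path_graph: "pair_graph (path_graph n)"
proof -
  have fin: "finite (parcs (path_graph n))"
    by (rule finite_subset[of _ "{..<n} \<times> {..<n}"]) (auto simp: path_graph_def)
  show ?thesis
    by unfold_locales
      (use fin in \<open>auto simp: path_graph_def symmetric_def sym_def\<close>)
qed

lemma simple_connected_path_graph:
  assumes "2 \<le> n"
  shows "simple_connected_graph (path_graph n)"
proof -
  interpret pair_graph "path_graph n"
    by (rule pair_graph_path_graph)
  have from0: "0 \<rightarrow>\<^sup>*\<^bsub>with_proj (path_graph n)\<^esub> i" if "i < n" for i
    using that
  proof (induction i)
    case 0
    then have "0 \<in> pverts (path_graph n)"
      by (simp add: path_graph_def)
    then show ?case by (rule reachable_refl)
  next
    case (Suc i)
    then have "(i, Suc i) \<in> parcs (path_graph n)"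
      by (auto simp: path_graph_def)
    with Suc show ?case
      by (auto intro: reachable_adj_trans)
  qed
  have to0: "i \<rightarrow>\<^sup>*\<^bsub>with_proj (path_graph n)\<^esub> 0" if "i < n" for i
    by (rule symmetric_reachable[OF pair_sym_arcs from0[OF that]])
  have "strongly_connected (with_proj (path_graph n))"
    unfolding strongly_connected_def
  proof (intro conjI ballI)
    show "verts (with_proj (path_graph n)) \<noteq> {}"
      using assms by (auto simp: path_graph_def lessThan_empty_iff)
  next
    fix u v
    assume "u \<in> verts (with_proj (path_graph n))" "v \<in> verts (with_proj (path_graph n))"
    then have "u < n" "v < n"
      by (simp_all add: path_graph_def)
    then show "u \<rightarrow>\<^sup>*\<^bsub>with_proj (path_graph n)\<^esub> v"
      by (rule reachable_trans[OF to0 from0])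
  qed
  then have "Digraph_Component.connected (with_proj (path_graph n))"
    unfolding Digraph_Component.connected_def strongly_connected_def
    by (auto intro: reachable_mk_symmetricI)
  then show ?thesis
    using assms pair_graph_path_graph
    by (simp add: simple_connected_graph_def) (simp add: path_graph_def)
qed

end

theory Submission
  imports Defs
begin

text \<open>
  In the path, \<open>R{x, y}\<close> is the whole vertex set with the midpoint of \<open>x\<close> and \<open>y\<close> removed, if
  there is one; the possible midpoints are exactly the inner vertices. For \<open>k \<le> 2\<close> the weight \<open>k\<close>
  is split evenly between the two ends. For \<open>k > 2\<close> the ends get weight \<open>1\<close> and every inner
  vertex \<open>(k - 2) / (n - 3)\<close>; this is optimal, as one sees by adding up the constraints
  \<open>g(V) - g(m) \<ge> k\<close> over the inner vertices \<open>m\<close>.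
\<close>

lemma pverts_path_graph [simp]: "pverts (path_graph n) = {..<n}"
  by (simp add: path_graph_def)

lemma parcs_path_graph [simp]:
  "parcs (path_graph n) = {(i, j). i < n \<and> j < n \<and> (j = i + 1 \<or> i = j + 1)}"
  by (simp add: path_graph_def)

text \<open>An arc changes the position by exactly one, so no walk from \<open>x\<close> to
  \<open>y\<close> is shorter than the difference; stepping straight towards \<open>y\<close>
  attains it.\<close>

lemma gdist_path_graph:
  assumes "x < n" "y < n"
  shows "int (gdist (path_graph n) x y) = \<bar>int x - int y\<bar>"
proof -
  interpret pair_graph "path_graph n"
    by (rule pair_graph_path_graph)
  have lower: "\<bar>int u - int v\<bar> \<le> int (length p)" if "awalk u p v" for u p v
    using that
  proof (induction p arbitrary: u)
    case Nil
    then show ?case by (simp add: awalk_Nil_iff)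
  next
    case (Cons e p)
    from Cons.prems have "awalk (snd e) p v" "u = fst e" "e \<in> parcs (path_graph n)"
      by (auto simp: awalk_Cons_iff)
    then show ?case
      using Cons.IH[of "snd e"] by auto
  qed
  \<comment> \<open>The last conjunct strengthens the induction: the path never strays further from
    \<open>y\<close> than its start, so a vertex prepended from further away is new and the walk
    stays a path.\<close>
  have "\<exists>p. apath x p y \<and> int (length p) = \<bar>int x - int y\<bar> \<and>
      (\<forall>v \<in> set (awalk_verts x p). \<bar>int v - int y\<bar> \<le> \<bar>int x - int y\<bar>)"
    using assms(1)
  proof (induction "nat \<bar>int x - int y\<bar>" arbitrary: x)
    case 0
    then show ?case using assms(2) by (intro exI[of _ "[]"]) (simp add: apath_Nil_iff)
  next
    case (Suc d)
    \<comment> \<open>The neighbour of \<open>x\<close> on the side of \<open>y\<close>. Here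
      \<open>x\<close> differs from \<open>y\<close>, so the \<open>else\<close> branch has
      \<open>0 < x\<close> and the subtraction does not truncate.\<close>
    define x' where "x' = (if x < y then x + 1 else x - 1)"
    have x': "x' < n" "d = nat \<bar>int x' - int y\<bar>" "(x, x') \<in> parcs (path_graph n)"
      using Suc.hyps(2) Suc.prems assms(2) by (auto simp: x'_def)
    with Suc.hyps(1) obtain p where p: "apath x' p y" "int (length p) = \<bar>int x' - int y\<bar>"
      "\<forall>v \<in> set (awalk_verts x' p). \<bar>int v - int y\<bar> \<le> \<bar>int x' - int y\<bar>"
      by blast
    have closer: "\<bar>int x - int y\<bar> = \<bar>int x' - int y\<bar> + 1"
      using x'(2) Suc.hyps(2) by linarith
    then have "x \<notin> set (awalk_verts x' p)"
      using p(3) by fastforce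
    with x' p closer show ?case
      by (intro exI[of _ "(x, x') # p"]) (auto simp: apath_Cons_iff)
  qed
  then obtain q where q: "apath x q y" "int (length q) = \<bar>int x - int y\<bar>"
    by blast
  have "gdist (path_graph n) x y = length q"
    unfolding gdist_def
  proof (rule Least_equality)
    show "length q \<le> l" if "\<exists>p. apath x p y \<and> length p = l" for l
      using that lower[OF awalkI_apath] q(2) by fastforce
  qed (use q(1) in blast)
  with q(2) show ?thesis by simp
qed

text \<open>On a line only the midpoint is equidistant from two distinct points. The equation
  \<open>2 * m = x + y\<close> covers both parities: it has no solution when the sum is odd.\<close>

lemma resolving_nbhd_path_graph:
  assumes "x < n" "y < n" "x \<noteq> y"
  shows "resolving_nbhd (path_graph n) x y = {..<n} - {m. 2 * m = x + y}"
proof -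
  have "gdist (path_graph n) x z \<noteq> gdist (path_graph n) y z \<longleftrightarrow> 2 * z \<noteq> x + y" if "z < n" for z
    using gdist_path_graph[OF assms(1) that] gdist_path_graph[OF assms(2) that] assms(3)
    by linarith
  then show ?thesis
    by (auto simp: resolving_nbhd_def)
qed

lemma resolving_nbhd_path_graph_0_1:
  assumes "2 \<le> n"
  shows "resolving_nbhd (path_graph n) 0 1 = {..<n}"
proof -
  have "{m::nat. 2 * m = 0 + 1} = {}"
    by auto
  then show ?thesis
    using assms resolving_nbhd_path_graph[of 0 n 1] by simp
qed

lemma resolving_nbhd_path_graph_neighbours:
  assumes "0 < m" "m < n - 1"
  shows "resolving_nbhd (path_graph n) (m - 1) (m + 1) = {..<n} - {m}"
  using assms by (subst resolving_nbhd_path_graph) auto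

text \<open>The midpoint of two distinct vertices lies strictly between them, hence is never an end
  of the path.\<close>

lemma resolving_nbhd_path_graph_cases:
  assumes "x < n" "y < n" "x \<noteq> y"
  obtains "resolving_nbhd (path_graph n) x y = {..<n}"
  | m where "0 < m" "m < n - 1" "resolving_nbhd (path_graph n) x y = {..<n} - {m}"
proof (cases "even (x + y)")
  case True
  then obtain m where m: "x + y = 2 * m" by blast
  then have "resolving_nbhd (path_graph n) x y = {..<n} - {m}"
    using assms by (subst resolving_nbhd_path_graph) auto
  then show ?thesis
    using that(2)[of m] m assms by linarith
next
  case False
  then have "{m. 2 * m = x + y} = {}"
    by (metis (mono_tags, lifting) Collect_empty_eq dvd_triv_left)
  then show ?thesis
    using that(1) assms by (simp add: resolving_nbhd_path_graph)
qed

text \<open>Serves to discharge the condition \<open>k <= kappa\<close> inside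
  \<open>k_resolving\<close>. The \<open>max\<close> accounts for \<open>n = 2\<close>, where no
  pair has a midpoint.\<close>

lemma kappa_path_graph_ge:
  assumes "2 \<le> n"
  shows "max 2 (n - 1) \<le> kappa (path_graph n)"
proof -
  define S where "S = {card (resolving_nbhd (path_graph n) x y) | x y.
    x \<in> pverts (path_graph n) \<and> y \<in> pverts (path_graph n) \<and> x \<noteq> y}"
  have "S = (\<lambda>(x, y). card (resolving_nbhd (path_graph n) x y)) `
      {(x, y). x < n \<and> y < n \<and> x \<noteq> y}"
    by (auto simp: S_def image_def)
  moreover have "finite {(x, y). x < n \<and> y < n \<and> x \<noteq> y}"
    by (rule finite_subset[of _ "{..<n} \<times> {..<n}"]) auto
  ultimately have "finite S" by simp
  moreover have "card (resolving_nbhd (path_graph n) 0 1) \<in> S"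
    using assms unfolding S_def by fastforce
  moreover have "max 2 (n - 1) \<le> c" if "c \<in> S" for c
  proof -
    from that obtain x y where xy: "x < n" "y < n" "x \<noteq> y"
      and c: "c = card (resolving_nbhd (path_graph n) x y)"
      by (auto simp: S_def)
    from xy show ?thesis
    proof (cases rule: resolving_nbhd_path_graph_cases)
      case 1
      then show ?thesis using assms by (simp add: c)
    next
      case (2 m)
      then have "c = n - 1" by (simp add: c)
      \<comment> \<open>An inner vertex exists, so \<open>n - 1\<close> is at least 2.\<close>
      with 2(1,2) show ?thesis by linarith
    qed
  qed
  ultimately show ?thesis
    unfolding kappa_def S_def[symmetric] by (intro Min.boundedI) auto
qed

text \<open>Turns the problem into a linear program with one constraint for the total and one per
  inner vertex; the bound on \<open>k\<close> covers both ranges of the theorem.\<close>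

lemma k_resolving_path_graph_iff:
  assumes "2 \<le> n" "1 \<le> k" "k \<le> max 2 (real n - 1)"
  shows "k_resolving (path_graph n) k g \<longleftrightarrow>
    (\<forall>v<n. g v \<in> {0..1}) \<and> k \<le> sum g {..<n} \<and>
    (\<forall>m. 0 < m \<and> m < n - 1 \<longrightarrow> k \<le> sum g {..<n} - g m)"
    (is "_ \<longleftrightarrow> ?R")
proof
  assume k_res: "k_resolving (path_graph n) k g"
  then have bound: "k \<le> sum g (resolving_nbhd (path_graph n) x y)"
    if "x < n" "y < n" "x \<noteq> y" for x y
    using that by (simp add: k_resolving_def)
  have "k \<le> sum g {..<n}"
    using bound[of 0 1] assms(1) by (simp add: resolving_nbhd_path_graph_0_1[simplified])
  moreover have "k \<le> sum g {..<n} - g m" if "0 < m" "m < n - 1" for m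
    using bound[of "m - 1" "m + 1"] that
    by (simp add: resolving_nbhd_path_graph_neighbours[simplified] sum_diff1)
  ultimately show ?R
    using k_res by (simp add: k_resolving_def)
next
  assume R: ?R
  have "k \<le> real (kappa (path_graph n))"
    using kappa_path_graph_ge[OF assms(1)] assms by linarith
  moreover have "k \<le> sum g (resolving_nbhd (path_graph n) x y)"
    if "x < n" "y < n" "x \<noteq> y" for x y
    using that by (cases rule: resolving_nbhd_path_graph_cases) (use R in \<open>auto simp: sum_diff1\<close>)
  ultimately show "k_resolving (path_graph n) k g"
    using R assms(2) by (simp add: k_resolving_def)
qed

lemma sum_lessThan_ends:
  fixes f :: "nat \<Rightarrow> real"
  assumes "2 \<le> n"
  shows "sum f {..<n} = f 0 + f (n - 1) + sum f {0<..<n - 1}"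
proof -
  have "{..<n} = insert 0 (insert (n - 1) {0<..<n - 1})"
    using assms by auto
  then show ?thesis
    using assms by simp
qed

lemma frac_k_metric_dim_path_graph_le_2:
  assumes "2 \<le> n" "1 \<le> k" "k \<le> 2"
  shows "frac_k_metric_dim (path_graph n) k = k"
  unfolding frac_k_metric_dim_def pverts_path_graph
proof (rule Least_equality)
  note k_res_iff = k_resolving_path_graph_iff[OF assms(1,2) order_trans[OF assms(3) max.cobounded1]]
  \<comment> \<open>The values lie in \<open>[0, 1]\<close> because \<open>k <= 2\<close>, and
    deleting an inner vertex costs no weight.\<close>
  define g where "g v = (if v = 0 \<or> v = n - 1 then k / 2 else 0)" for v
  have "sum g {..<n} = k"
    using assms(1) by (simp add: sum_lessThan_ends g_def)
  moreover from this have "k_resolving (path_graph n) k g"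
    using assms(2,3) by (auto simp: k_res_iff g_def)
  ultimately show "\<exists>g. k_resolving (path_graph n) k g \<and> k = sum g {..<n}"
    by metis
  show "k \<le> w" if "\<exists>g. k_resolving (path_graph n) k g \<and> w = sum g {..<n}" for w
    using that by (auto simp: k_res_iff)
qed

lemma frac_k_metric_dim_path_graph_gt_2:
  assumes "2 < k" "k \<le> real n - 1"
  shows "frac_k_metric_dim (path_graph n) k = 2 + (k - 2) * ((real n - 2) / (real n - 3))"
  unfolding frac_k_metric_dim_def pverts_path_graph
proof (rule Least_equality)
  \<comment> \<open>Makes the denominator \<open>real n - 3\<close> positive.\<close>
  have n: "3 < n"
    using assms by linarith
  have k_res_iff: "k_resolving (path_graph n) k g \<longleftrightarrow>
      (\<forall>v<n. g v \<in> {0..1}) \<and> k \<le> sum g {..<n} \<and>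
      (\<forall>m. 0 < m \<and> m < n - 1 \<longrightarrow> k \<le> sum g {..<n} - g m)" for g
    using n assms by (intro k_resolving_path_graph_iff) auto
  \<comment> \<open>Chosen so that every inner constraint is tight:
    \<open>2 + (n - 3) * c = k\<close>. The bound \<open>c <= 1\<close> is
    \<open>k <= n - 1\<close>.\<close>
  define c where "c = (k - 2) / (real n - 3)"
  have c: "0 \<le> c" "c \<le> 1" "2 + (real n - 2) * c - c = k"
  proof -
    have "(real n - 3) * c = k - 2"
      using n by (simp add: c_def)
    then show "2 + (real n - 2) * c - c = k"
      by (simp add: algebra_simps)
  qed (use n assms in \<open>simp_all add: c_def\<close>)
  define g where "g v = (if v = 0 \<or> v = n - 1 then 1 else c)" for v
  have "sum g {0<..<n - 1} = (\<Sum>v \<in> {0<..<n - 1}. c)"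
    by (rule sum.cong) (auto simp: g_def)
  then have total: "sum g {..<n} = 2 + (real n - 2) * c"
    using n by (simp add: sum_lessThan_ends g_def of_nat_diff)
  have "k_resolving (path_graph n) k g"
    unfolding k_res_iff total using c by (auto simp: g_def)
  moreover have "2 + (k - 2) * ((real n - 2) / (real n - 3)) = sum g {..<n}"
    by (simp add: total c_def)
  ultimately show "\<exists>g. k_resolving (path_graph n) k g \<and>
      2 + (k - 2) * ((real n - 2) / (real n - 3)) = sum g {..<n}"
    by blast
  show "2 + (k - 2) * ((real n - 2) / (real n - 3)) \<le> w"
    if "\<exists>g. k_resolving (path_graph n) k g \<and> w = sum g {..<n}" for w
  proof -
    from that obtain g where g: "k_resolving (path_graph n) k g" and w: "w = sum g {..<n}"
      by blast
    have ends: "g 0 \<le> 1" "g (n - 1) \<le> 1"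
      using g n by (auto simp: k_res_iff)
    have "(\<Sum>m \<in> {0<..<n - 1}. k) \<le> (\<Sum>m \<in> {0<..<n - 1}. w - g m)"
      using g by (intro sum_mono) (simp add: k_res_iff w)
    then have "(real n - 2) * k \<le> (real n - 2) * w - sum g {0<..<n - 1}"
      using n by (simp add: sum_subtractf of_nat_diff)
    also have "sum g {0<..<n - 1} = w - g 0 - g (n - 1)"
      using n by (simp add: w sum_lessThan_ends)
    \<comment> \<open>The two ends contribute at most 2. Dividing by \<open>n - 3\<close> gives the
      claim, as \<open>(n - 2) * k - 2 = 2 * (n - 3) + (k - 2) * (n - 2)\<close>.\<close>
    finally have "(real n - 2) * k - 2 \<le> (real n - 3) * w"
      using ends by (simp add: algebra_simps)
    then show ?thesis
      using n by (simp add: field_simps)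
  qed
qed

theorem proposition4p1:
  shows "(\<forall>k::real. 1 \<le> k \<and> k \<le> 2 \<longrightarrow> frac_k_metric_dim (path_graph 2) k = k) \<and>
    (\<forall>(n::nat) (k::real). 3 \<le> n \<longrightarrow>
       (1 \<le> k \<and> k \<le> 2 \<longrightarrow> frac_k_metric_dim (path_graph n) k = k) \<and>
       (2 < k \<and> k \<le> real n - 1 \<longrightarrow>
          frac_k_metric_dim (path_graph n) k = 2 + (k - 2) * ((real n - 2) / (real n - 3))))"
  using frac_k_metric_dim_path_graph_le_2 frac_k_metric_dim_path_graph_gt_2 by simp

end
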